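(* Let $X,U,Z,Y$ be complex Hilbert spaces and let $S=\begin{bmatrix}A\&B\\ C\&D\end{bmatrix}\colon\mathrm{dom}(S)\subseteq X\times U\to Z\times Y$ together with $E\colon X\to Z$ be an $E$-operator node on $(X,U,Z,Y)$ with main operator $A$. Then: a) There exists a unique operator $B\in L(U,Z_{-1})$ such that $\begin{bmatrix}A_{-1}&B\end{bmatrix}\colon X\times U\to Z_{-1}$ is an extension of $A\&B$ and $$\mathrm{dom}(S)=\Big\{\begin{pmatrix}x\\ u\end{pmatrix}\in X\times U\;:\;A_{-1}x+Bu\in Z\Big\}.$$ b) The operator $C\&D$ is continuous from $\mathrm{dom}(S)$ with the graph norm to $Y$, and the operator $C\colon X_1\to Y$ defined by $Cx=C\&D\begin{pmatrix}x\\ 0\end{pmatrix}$, $x\in X_1$, is continuous from $X_1$ to $Y$. c) For all $u\in U$ there exists an $x\in X$ such that $\begin{pmatrix}x\\ u\end{pmatrix}\in\mathrm{dom}(A\&B)$ and $A\&B\begin{pmatrix}x\\ u\end{pmatrix}\in\mathrm{ran}\,E$. d) For every $\lambda\in\rho(E,A)$ the operator $$F_\lambda=\begin{bmatrix}I&-(\lambda E-A_{-1})^{-1}B\\ 0&I\end{bmatrix}\colon X\times U\to X\times U$$ is boundedly invertible and maps $\mathrm{dom}(S)$ one-to-one onto $X_1\times U$.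
   Context: For a linear operator $S\colon\mathrm{dom}(S)\subseteq X\times U\to Z\times Y$, with $P_Z,P_Y$ the canonical projections of $Z\times Y$ onto $Z$ and $Y$, set $A\&B=P_ZS$ and $C\&D=P_YS$, both with domain $\mathrm{dom}(S)$. The main operator of $S$ is $A\colon\mathrm{dom}(A)\subseteq X\to Z$, $Ax=P_ZS\begin{pmatrix}x\\ 0\end{pmatrix}$, $\mathrm{dom}(A)=\{x\in X:\begin{pmatrix}x\\ 0\end{pmatrix}\in\mathrm{dom}(S)\}$. $\rho(E,A)$ is the set of $\lambda\in\mathbb{C}$ such that $\lambda E-A\colon\mathrm{dom}(A)\to Z$ is bijective with $(\lambda E-A)^{-1}\in L(Z,X)$. $S$ together with a linear operator $E\colon X\to Z$ is an $E$-operator node on $(X,U,Z,Y)$ if: (i) $S$ is closed and $E$ is bounded; (ii) $A\&B$ (with domain $\mathrm{dom}(S)$) is closed; (iii) $\rho(E,A)\ne\emptyset$ and $\mathrm{dom}(A)$ is dense in $X$; (iv) for all $u\in U$ there exists $x\in X$ with $\begin{pmatrix}x\\ u\end{pmatrix}\in\mathrm{dom}(A\&B)$. Then $A$ is closed. For a fixed $\mu\in\rho(E,A)$: $X_1$ is $\mathrm{dom}(A)$ with norm $\|(\mu E-A)x\|_Z$ (equivalent to the graph norm of $A$); $Z_{-1}$ is the completion of $Z$ in the norm $\|(\mu E-A)^{-1}z\|_X$ (different $\mu$ give equivalent norms). $A_{-1}\in L(X,Z_{-1})$ is the unique bounded extension of $A$ to $X$; $\lambda E-A_{-1}\colon X\to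 Z_{-1}$ is boundedly invertible for every $\lambda\in\rho(E,A)$. *)

theory Defs
  imports "HOL-Analysis.Analysis"
begin

section \<open>Complex Hilbert spaces\<close>

class complex_vector = real_vector +
  fixes scaleC :: "complex \<Rightarrow> 'a \<Rightarrow> 'a"  (infixr \<open>*\<^sub>C\<close> 75)
  assumes scaleC_add_right: "a *\<^sub>C (x + y) = a *\<^sub>C x + a *\<^sub>C y"
    and scaleC_add_left: "(a + b) *\<^sub>C x = a *\<^sub>C x + b *\<^sub>C x"
    and scaleC_scaleC: "a *\<^sub>C (b *\<^sub>C x) = (a * b) *\<^sub>C x"
    and scaleC_of_real: "complex_of_real r *\<^sub>C x = r *\<^sub>R x"

class complex_normed_vector = complex_vector + real_normed_vector +
  assumes norm_scaleC: "norm (a *\<^sub>C x) = cmod a * norm x"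

class cbanach = complex_normed_vector + complete_space

text \<open>The inner product is linear in its first argument. Positivity and definiteness are contained
  in the last axiom, since the norm is one already.\<close>

class complex_inner = complex_normed_vector +
  fixes cinner :: "'a \<Rightarrow> 'a \<Rightarrow> complex"
  assumes cinner_commute: "cinner x y = cnj (cinner y x)"
    and cinner_add_left: "cinner (x + y) z = cinner x z + cinner y z"
    and cinner_scaleC_left: "cinner (a *\<^sub>C x) y = a * cinner x y"
    and cinner_self: "cinner x x = complex_of_real ((norm x)\<^sup>2)"

class chilbert_space = complex_inner + complete_space
begin
subclass cbanach ..
end

instantiation complex :: chilbert_space
begin
definition scaleC_complex :: "complex \<Rightarrow> complex \<Rightarrow> complex"
  where "scaleC_complex a x = a * x"
definition cinner_complex :: "complex \<Rightarrow> complex \<Rightarrow> complex"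
  where "cinner_complex x y = x * cnj y"
instance
  by standard
    (auto simp: scaleC_complex_def cinner_complex_def algebra_simps norm_mult
      scaleR_conv_of_real complex_norm_square simp del: of_real_power)
end

text \<open>The product carries the norm $\|(x,y)\|^2 = \|x\|^2 + \|y\|^2$ of the library.\<close>

instantiation prod :: (complex_vector, complex_vector) complex_vector
begin
definition scaleC_prod :: "complex \<Rightarrow> 'a \<times> 'b \<Rightarrow> 'a \<times> 'b"
  where "scaleC_prod a p = (a *\<^sub>C fst p, a *\<^sub>C snd p)"
instance
  by standard (auto simp: scaleC_prod_def scaleC_add_right scaleC_add_left scaleC_scaleC
      scaleC_of_real scaleR_prod_def)
end

instance prod :: (complex_normed_vector, complex_normed_vector) complex_normed_vector
  by standard (auto simp: scaleC_prod_def norm_prod_def norm_scaleC power_mult_distrib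
      real_sqrt_mult simp flip: distrib_left)

instance prod :: (cbanach, cbanach) cbanach ..

instantiation prod :: (complex_inner, complex_inner) complex_inner
begin
definition cinner_prod :: "'a \<times> 'b \<Rightarrow> 'a \<times> 'b \<Rightarrow> complex"
  where "cinner_prod p q = cinner (fst p) (fst q) + cinner (snd p) (snd q)"
instance
proof
  fix x y z :: "'a \<times> 'b" and a
  show "cinner x y = cnj (cinner y x)"
    by (metis cinner_commute cinner_prod_def complex_cnj_add)
  show "cinner (x + y) z = cinner x z + cinner y z"
    by (simp add: cinner_prod_def cinner_add_left)
  show "cinner (a *\<^sub>C x) y = a * cinner x y"
    by (simp add: cinner_prod_def scaleC_prod_def cinner_scaleC_left distrib_left)
  show "cinner x x = complex_of_real ((norm x)\<^sup>2)"
    by (simp add: cinner_prod_def cinner_self norm_prod_def)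
qed
end

instance prod :: (chilbert_space, chilbert_space) chilbert_space ..


section \<open>Linear operators\<close>

text \<open>An operator is a domain together with a total function; the values of the function outside the
  domain are irrelevant.\<close>

definition csubspace :: "'a::complex_vector set \<Rightarrow> bool" where
  "csubspace D \<longleftrightarrow> 0 \<in> D \<and> (\<forall>x\<in>D. \<forall>y\<in>D. x + y \<in> D) \<and> (\<forall>a. \<forall>x\<in>D. a *\<^sub>C x \<in> D)"

definition clinear_on :: "'a::complex_vector set \<Rightarrow> ('a \<Rightarrow> 'b::complex_vector) \<Rightarrow> bool" where
  "clinear_on D T \<longleftrightarrow> csubspace D \<and> (\<forall>x\<in>D. \<forall>y\<in>D. T (x + y) = T x + T y) \<and>
     (\<forall>a. \<forall>x\<in>D. T (a *\<^sub>C x) = a *\<^sub>C T x)"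

definition cbounded_linear :: "('a::complex_normed_vector \<Rightarrow> 'b::complex_normed_vector) \<Rightarrow> bool" where
  "cbounded_linear T \<longleftrightarrow> clinear_on UNIV T \<and> (\<exists>K. \<forall>x. norm (T x) \<le> K * norm x)"

definition boundedly_invertible :: "('a::complex_normed_vector \<Rightarrow> 'b::complex_normed_vector) \<Rightarrow> bool" where
  "boundedly_invertible T \<longleftrightarrow> cbounded_linear T \<and> bij T \<and> cbounded_linear (inv T)"

definition closed_operator :: "'a::complex_normed_vector set \<Rightarrow> ('a \<Rightarrow> 'b::complex_normed_vector) \<Rightarrow> bool" where
  "closed_operator D T \<longleftrightarrow> closed {(x, T x) |x. x \<in> D}"

text \<open>The product norm gives $(\|x\|^2 + \|Tx\|^2)^{1/2}$.\<close>

definition graph_norm :: "('a::complex_normed_vector \<Rightarrow> 'b::complex_normed_vector) \<Rightarrow> 'a \<Rightarrow> real" where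
  "graph_norm T x = norm (x, T x)"

text \<open>Continuity on the subspace D when D is given the norm N instead of the norm of the
  surrounding type.\<close>

definition continuous_wrt :: "'a::complex_vector set \<Rightarrow> ('a \<Rightarrow> real) \<Rightarrow> ('a \<Rightarrow> 'b::complex_normed_vector) \<Rightarrow> bool" where
  "continuous_wrt D N T \<longleftrightarrow>
     (\<forall>x\<in>D. \<forall>e>0. \<exists>d>0. \<forall>y\<in>D. N (y - x) < d \<longrightarrow> norm (T y - T x) < e)"


section \<open>E-operator nodes\<close>

definition AB :: "('x \<times> 'u \<Rightarrow> 'z \<times> 'y) \<Rightarrow> 'x \<times> 'u \<Rightarrow> 'z" where
  "AB S p = fst (S p)"

definition CD :: "('x \<times> 'u \<Rightarrow> 'z \<times> 'y) \<Rightarrow> 'x \<times> 'u \<Rightarrow> 'y" where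
  "CD S p = snd (S p)"

definition main_dom :: "('x \<times> 'u::zero) set \<Rightarrow> 'x set" where
  "main_dom D = {x. (x, 0) \<in> D}"

definition main_op :: "('x \<times> 'u::zero \<Rightarrow> 'z \<times> 'y) \<Rightarrow> 'x \<Rightarrow> 'z" where
  "main_op S x = fst (S (x, 0))"

definition pencil :: "('x \<Rightarrow> 'z::complex_vector) \<Rightarrow> ('x \<Rightarrow> 'z) \<Rightarrow> complex \<Rightarrow> 'x \<Rightarrow> 'z" where
  "pencil E A l x = l *\<^sub>C E x - A x"

definition resolvent :: "('x \<Rightarrow> 'z::complex_vector) \<Rightarrow> 'x set \<Rightarrow> ('x \<Rightarrow> 'z) \<Rightarrow> complex \<Rightarrow> 'z \<Rightarrow> 'x" where
  "resolvent E dA A l = inv_into dA (pencil E A l)"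

definition resolvent_set ::
    "('x::complex_normed_vector \<Rightarrow> 'z::complex_normed_vector) \<Rightarrow> 'x set \<Rightarrow> ('x \<Rightarrow> 'z) \<Rightarrow> complex set" where
  "resolvent_set E dA A =
     {l. bij_betw (pencil E A l) dA UNIV \<and> cbounded_linear (resolvent E dA A l)}"

definition operator_node ::
    "('x::chilbert_space \<times> 'u::chilbert_space) set \<Rightarrow> ('x \<times> 'u \<Rightarrow> 'z::chilbert_space \<times> 'y::chilbert_space)
     \<Rightarrow> ('x \<Rightarrow> 'z) \<Rightarrow> bool" where
  "operator_node D S E \<longleftrightarrow>
     clinear_on D S \<and> closed_operator D S \<and> cbounded_linear E \<and>
     closed_operator D (AB S) \<and>
     resolvent_set E (main_dom D) (main_op S) \<noteq> {} \<and> closure (main_dom D) = UNIV \<and>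
     (\<forall>u. \<exists>x. (x, u) \<in> D)"


section \<open>The spaces \<open>X\<^sub>1\<close> and \<open>Z\<^sub>-\<^sub>1\<close>\<close>

text \<open>\<open>X\<^sub>1\<close> is the set \<^term>\<open>main_dom D\<close> with this norm.\<close>

definition norm_X1 ::
    "('x \<times> 'u::zero \<Rightarrow> 'z::complex_normed_vector \<times> 'y) \<Rightarrow> ('x \<Rightarrow> 'z) \<Rightarrow> complex \<Rightarrow> 'x \<Rightarrow> real" where
  "norm_X1 S E \<mu> x = norm (pencil E (main_op S) \<mu> x)"

text \<open>A completion of a vector space in a norm N is a Banach space into which the space embeds
  isometrically with dense range. The embedding is part of the data and identifies the space with a
  subset of its completion.\<close>

definition is_completion :: "('z::complex_vector \<Rightarrow> real) \<Rightarrow> ('z \<Rightarrow> 'w::cbanach) \<Rightarrow> bool" where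
  "is_completion N \<iota> \<longleftrightarrow>
     clinear_on UNIV \<iota> \<and> (\<forall>z. norm (\<iota> z) = N z) \<and> closure (range \<iota>) = UNIV"

text \<open>Here \<open>\<iota>\<close> embeds Z into \<open>Z\<^sub>-\<^sub>1\<close>.\<close>

definition is_Zm1 ::
    "('x::chilbert_space \<times> 'u::chilbert_space) set \<Rightarrow> ('x \<times> 'u \<Rightarrow> 'z::chilbert_space \<times> 'y::chilbert_space)
     \<Rightarrow> ('x \<Rightarrow> 'z) \<Rightarrow> complex \<Rightarrow> ('z \<Rightarrow> 'w::cbanach) \<Rightarrow> bool" where
  "is_Zm1 D S E \<mu> \<iota> \<longleftrightarrow>
     is_completion (\<lambda>z. norm (resolvent E (main_dom D) (main_op S) \<mu> z)) \<iota>"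

definition Am1 ::
    "('x::chilbert_space \<times> 'u::chilbert_space) set \<Rightarrow> ('x \<times> 'u \<Rightarrow> 'z::chilbert_space \<times> 'y::chilbert_space)
     \<Rightarrow> ('z \<Rightarrow> 'w::cbanach) \<Rightarrow> 'x \<Rightarrow> 'w" where
  "Am1 D S \<iota> = (THE T. cbounded_linear T \<and> (\<forall>x\<in>main_dom D. T x = \<iota> (main_op S x)))"

definition is_control_op ::
    "('x::chilbert_space \<times> 'u::chilbert_space) set \<Rightarrow> ('x \<times> 'u \<Rightarrow> 'z::chilbert_space \<times> 'y::chilbert_space)
     \<Rightarrow> ('z \<Rightarrow> 'w::cbanach) \<Rightarrow> ('u \<Rightarrow> 'w) \<Rightarrow> bool" where
  "is_control_op D S \<iota> B \<longleftrightarrow>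
     cbounded_linear B \<and>
     (\<forall>(x, u) \<in> D. Am1 D S \<iota> x + B u = \<iota> (AB S (x, u))) \<and>
     D = {(x, u). Am1 D S \<iota> x + B u \<in> range \<iota>}"

definition F_op ::
    "('x::chilbert_space \<times> 'u::chilbert_space) set \<Rightarrow> ('x \<times> 'u \<Rightarrow> 'z::chilbert_space \<times> 'y::chilbert_space)
     \<Rightarrow> ('x \<Rightarrow> 'z) \<Rightarrow> ('z \<Rightarrow> 'w::cbanach) \<Rightarrow> ('u \<Rightarrow> 'w) \<Rightarrow> complex \<Rightarrow> 'x \<times> 'u \<Rightarrow> 'x \<times> 'u" where
  "F_op D S E \<iota> B l = (\<lambda>(x, u). (x - inv (pencil (\<iota> \<circ> E) (Am1 D S \<iota>) l) (B u), u))"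


section \<open>The extrapolation space and the extended operator exist\<close>

lemma scaleC_zero_right [simp]: "a *\<^sub>C (0::'a::complex_vector) = 0"
  using scaleC_add_right[of a 0 0] by simp

lemma scaleC_minus_one: "(- 1) *\<^sub>C x = - (x::'a::complex_vector)"
  using scaleC_of_real[of "-1" x] by simp

lemma main_dom_clinear:
  assumes "clinear_on D S"
  shows "clinear_on (main_dom D) (main_op S)"
proof -
  have *: "(x + y, 0) = (x, 0) + (y, 0::'b)" "(a *\<^sub>C x, 0) = a *\<^sub>C (x, 0::'b)" for x y :: 'a and a
    by (auto simp: scaleC_prod_def)
  show ?thesis
    using assms unfolding clinear_on_def csubspace_def main_dom_def main_op_def
    by (simp add: * zero_prod_def[symmetric] del: add_Pair) (simp add: scaleC_prod_def)
qed

lemma Zm1_exists: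
  assumes "operator_node D S E" and mu: "\<mu> \<in> resolvent_set E (main_dom D) (main_op S)"
  shows "is_Zm1 D S E \<mu> (resolvent E (main_dom D) (main_op S) \<mu>)"
proof -
  have "bij_betw (resolvent E (main_dom D) (main_op S) \<mu>) UNIV (main_dom D)"
    using mu by (auto simp: resolvent_set_def resolvent_def intro: bij_betw_inv_into)
  with assms show ?thesis
    by (auto simp: is_Zm1_def is_completion_def resolvent_set_def cbounded_linear_def
        operator_node_def bij_betw_def)
qed

lemma clinear_on_diff:
  assumes "clinear_on D T" "x \<in> D" "y \<in> D"
  shows "x - y \<in> D \<and> T (x - y) = T x - T y"
proof -
  have "x - y = x + (- 1) *\<^sub>C y" "T x - T y = T x + (- 1) *\<^sub>C T y"
    by (simp_all add: scaleC_minus_one)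
  then show ?thesis
    using assms unfolding clinear_on_def csubspace_def by metis
qed

lemma continuous_on_scaleC [continuous_intros]:
  fixes f :: "'b::topological_space \<Rightarrow> 'a::complex_normed_vector"
  assumes "continuous_on s f"
  shows "continuous_on s (\<lambda>x. a *\<^sub>C f x)"
proof -
  have "bounded_linear ((*\<^sub>C) a :: 'a \<Rightarrow> 'a)"
  proof (rule bounded_linear_intro[where K = "cmod a"])
    fix r and x :: 'a
    show "a *\<^sub>C r *\<^sub>R x = r *\<^sub>R a *\<^sub>C x"
      by (simp add: scaleC_scaleC mult.commute flip: scaleC_of_real)
  qed (simp_all add: scaleC_add_right norm_scaleC)
  from bounded_linear.continuous_on[OF this assms] show ?thesis .
qed

lemma cbounded_linear_continuous_on:
  assumes "cbounded_linear T"
  shows "continuous_on s T"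
proof -
  obtain K where K: "norm (T x) \<le> K * norm x" for x
    using assms by (auto simp: cbounded_linear_def)
  have "bounded_linear T"
  proof (rule bounded_linear_intro[where K = K])
    show "T (r *\<^sub>R x) = r *\<^sub>R T x" for r x
      using assms by (simp add: cbounded_linear_def clinear_on_def flip: scaleC_of_real)
    show "T (x + y) = T x + T y" for x y
      using assms by (simp add: cbounded_linear_def clinear_on_def)
  qed (use K in \<open>simp add: mult.commute\<close>)
  then show ?thesis
    by (simp add: linear_continuous_on)
qed

lemma continuous_eq_on_dense:
  fixes f g :: "'a::topological_space \<Rightarrow> 'b::t2_space"
  assumes "closure D = UNIV" "continuous_on UNIV f" "continuous_on UNIV g" "\<And>x. x \<in> D \<Longrightarrow> f x = g x"
  shows "f x = g x"
proof -
  have "closed {x. f x = g x}"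
    using assms by (intro closed_Collect_eq)
  moreover have "D \<subseteq> {x. f x = g x}"
    using assms by auto
  ultimately have "closure D \<subseteq> {x. f x = g x}"
    by (rule closure_minimal[rotated])
  then show ?thesis
    using assms by auto
qed

lemma bounded_extension_exists_unique:
  fixes f :: "'a::complex_normed_vector \<Rightarrow> 'b::cbanach"
  assumes lin: "clinear_on D f" and dense: "closure D = UNIV"
    and bound: "\<And>x. x \<in> D \<Longrightarrow> norm (f x) \<le> K * norm x"
  shows "\<exists>!T. cbounded_linear T \<and> (\<forall>x\<in>D. T x = f x)"
proof (rule ex_ex1I)
  have "uniformly_continuous_on D f"
    unfolding uniformly_continuous_on_def
  proof (intro allI impI)
    fix e :: real assume "e > 0"
    have "dist (f x') (f x) < e" if "x \<in> D" "x' \<in> D" "dist x' x < e / (\<bar>K\<bar> + 1)" for x x'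
    proof -
      have "dist (f x') (f x) = norm (f (x' - x))" "x' - x \<in> D"
        using clinear_on_diff[OF lin] that by (auto simp: dist_norm)
      then have "dist (f x') (f x) \<le> K * dist x' x"
        using bound by (simp add: dist_norm)
      also have "\<dots> \<le> (\<bar>K\<bar> + 1) * dist x' x"
        by (intro mult_right_mono) auto
      also have "\<dots> < e"
        using that(3) by (simp add: field_simps)
      finally show ?thesis .
    qed
    moreover have "e / (\<bar>K\<bar> + 1) > 0"
      using \<open>e > 0\<close> by simp
    ultimately show "\<exists>d>0. \<forall>x\<in>D. \<forall>x'\<in>D. dist x' x < d \<longrightarrow> dist (f x') (f x) < e"
      by blast
  qed
  then obtain g where "uniformly_continuous_on (closure D) g" and g: "\<And>x. x \<in> D \<Longrightarrow> f x = g x"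
    using uniformly_continuous_on_extension_on_closure by metis
  then have cont: "continuous_on UNIV g"
    using dense uniformly_continuous_imp_continuous by metis
  then have cont': "continuous_on UNIV (\<lambda>x. g (h x))" if "continuous_on UNIV h" for h :: "'a \<Rightarrow> 'a"
    using that continuous_on_compose2 by blast
  have D: "x + y \<in> D" "f (x + y) = f x + f y" "a *\<^sub>C x \<in> D" "f (a *\<^sub>C x) = a *\<^sub>C f x"
    if "x \<in> D" "y \<in> D" for x y a
    using lin that by (auto simp: clinear_on_def csubspace_def)
  have add1: "g (x + y) = g x + g y" if "y \<in> D" for x y
    by (rule continuous_eq_on_dense[OF dense, where f = "\<lambda>x. g (x + y)"])
      (use that D in \<open>auto intro!: continuous_intros cont' cont simp flip: g\<close>)
  have add: "g (x + y) = g x + g y" for x y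
    by (rule continuous_eq_on_dense[OF dense, where f = "\<lambda>y. g (x + y)"])
      (use add1 in \<open>auto intro!: continuous_intros cont' cont\<close>)
  have scale: "g (a *\<^sub>C x) = a *\<^sub>C g x" for a x
    by (rule continuous_eq_on_dense[OF dense, where f = "\<lambda>x. g (a *\<^sub>C x)"])
      (use D in \<open>auto intro!: continuous_intros cont' cont simp flip: g\<close>)
  have "closed {x. norm (g x) \<le> K * norm x}"
    by (intro closed_Collect_le continuous_intros cont)
  moreover have "D \<subseteq> {x. norm (g x) \<le> K * norm x}"
    using bound g by auto
  ultimately have "closure D \<subseteq> {x. norm (g x) \<le> K * norm x}"
    by (rule closure_minimal[rotated])
  then have "cbounded_linear g"
    using add scale dense by (auto simp: cbounded_linear_def clinear_on_def csubspace_def)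
  with g show "\<exists>T. cbounded_linear T \<and> (\<forall>x\<in>D. T x = f x)"
    by auto
next
  fix T T'
  assume "cbounded_linear T \<and> (\<forall>x\<in>D. T x = f x)" "cbounded_linear T' \<and> (\<forall>x\<in>D. T' x = f x)"
  then show "T = T'"
    using continuous_eq_on_dense[OF dense, of T T'] cbounded_linear_continuous_on by fastforce
qed

lemma Am1_exists_unique:
  assumes node: "operator_node D S E"
    and mu: "\<mu> \<in> resolvent_set E (main_dom D) (main_op S)" and Z: "is_Zm1 D S E \<mu> \<iota>"
  shows "\<exists>!T. cbounded_linear T \<and> (\<forall>x\<in>main_dom D. T x = \<iota> (main_op S x))"
proof -
  let ?R = "resolvent E (main_dom D) (main_op S) \<mu>"
  have A: "clinear_on (main_dom D) (main_op S)"
    using node main_dom_clinear by (auto simp: operator_node_def)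
  have \<iota>: "clinear_on UNIV \<iota>" and norm_\<iota>: "norm (\<iota> z) = norm (?R z)" for z
    using Z by (auto simp: is_Zm1_def is_completion_def)
  obtain K where K: "norm (E x) \<le> K * norm x" for x
    using node by (auto simp: operator_node_def cbounded_linear_def)
  obtain L where L: "norm (?R z) \<le> L * norm z" for z
    using mu by (auto simp: resolvent_set_def cbounded_linear_def)
  have R: "clinear_on UNIV ?R" and inj: "inj_on (pencil E (main_op S) \<mu>) (main_dom D)"
    using mu by (auto simp: resolvent_set_def cbounded_linear_def bij_betw_def)
  have "norm (\<iota> (main_op S x)) \<le> (cmod \<mu> * (\<bar>L\<bar> * \<bar>K\<bar>) + 1) * norm x" if "x \<in> main_dom D" for x
  proof -
    have "main_op S x = \<mu> *\<^sub>C E x - pencil E (main_op S) \<mu> x"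
      by (simp add: pencil_def)
    then have "?R (main_op S x) = \<mu> *\<^sub>C ?R (E x) - ?R (pencil E (main_op S) \<mu> x)"
      using clinear_on_diff[OF R] R by (simp add: clinear_on_def)
    also have "?R (pencil E (main_op S) \<mu> x) = x"
      using inj that by (simp add: resolvent_def)
    finally have "norm (\<iota> (main_op S x)) \<le> cmod \<mu> * norm (?R (E x)) + norm x"
      using norm_triangle_ineq4[of "\<mu> *\<^sub>C ?R (E x)" x] by (simp add: norm_\<iota> norm_scaleC)
    moreover have "norm (?R (E x)) \<le> \<bar>L\<bar> * norm (E x)"
      using L[of "E x"] by (smt (verit) mult_right_mono norm_ge_zero)
    moreover have "norm (E x) \<le> \<bar>K\<bar> * norm x"
      using K[of x] by (smt (verit) mult_right_mono norm_ge_zero)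
    then have "\<bar>L\<bar> * norm (E x) \<le> \<bar>L\<bar> * (\<bar>K\<bar> * norm x)"
      by (intro mult_left_mono) auto
    ultimately have "norm (\<iota> (main_op S x)) \<le> cmod \<mu> * (\<bar>L\<bar> * (\<bar>K\<bar> * norm x)) + norm x"
      by (smt (verit) mult_left_mono norm_ge_zero)
    then show ?thesis
      by (simp add: algebra_simps)
  qed
  moreover have "clinear_on (main_dom D) (\<lambda>x. \<iota> (main_op S x))"
    using A \<iota> by (simp add: clinear_on_def)
  moreover have "closure (main_dom D) = UNIV"
    using node by (simp add: operator_node_def)
  ultimately show ?thesis
    by (intro bounded_extension_exists_unique)
qed

end

theory Submission
  imports Defs
begin

text \<open>Everything rests on the equation \<open>A&B (x, u) = \<mu> E x - z\<close>. As \<open>\<mu>\<close> is in the resolvent set, each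
  \<open>(z, u)\<close> has exactly one solution \<open>x\<close>, and the map \<open>Q\<close> sending \<open>(z, u)\<close> to
  \<open>(x, C&D (x, u))\<close> has a closed graph because \<open>S\<close> is closed; hence it is bounded. This gives (b),
  as \<open>C&D (x, u)\<close> is the second component of \<open>Q\<close> at \<open>(\<mu> E x - A&B (x, u), u)\<close>. The solution
  \<open>x = G u\<close> for \<open>z = 0\<close> satisfies \<open>A&B (x, u) = E (\<mu> x)\<close>, which is (c), and
  \<open>B = (\<mu> E - A\<^sub>-\<^sub>1) G\<close> is the operator of (a). Finally \<open>\<lambda> E - A\<^sub>-\<^sub>1\<close> is boundedly invertible
  and maps exactly \<open>dom A\<close> into \<open>Z\<close>; applied to the first component of \<open>F\<^sub>\<lambda> (x, u)\<close> it gives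
  \<open>\<lambda> E x - (A\<^sub>-\<^sub>1 x + B u)\<close>, whence (d).\<close>

instance cbanach \<subseteq> banach ..

section \<open>The closed graph theorem\<close>

text \<open>The closure of \<open>A \<times> A\<close> is the product of the closures, and a
  continuous map sends the closure of a set into the closure of its image.\<close>

lemma closure_closed_under_binary:
  assumes "x \<in> closure A" "y \<in> closure A"
    and closed: "\<And>a b. a \<in> A \<Longrightarrow> b \<in> A \<Longrightarrow> g a b \<in> A"
    and cont: "continuous_on UNIV (\<lambda>p. g (fst p) (snd p))"
  shows "g x y \<in> closure A"
proof -
  have "(\<lambda>p. g (fst p) (snd p)) ` closure (A \<times> A) \<subseteq> closure A"
    by (rule image_closure_subset)
      (use closed cont in \<open>auto intro: continuous_on_subset closure_subset[THEN subsetD]\<close>)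
  with assms(1,2) show ?thesis
    unfolding closure_Times by force
qed

text \<open>Baire: the closure of some sublevel set of \<open>norm \<circ> T\<close> contains a ball, and it is symmetric and
  convex, so that it contains a ball around 0.\<close>

lemma closed_graph_approximation:
  fixes T :: "'a::banach \<Rightarrow> 'b::real_normed_vector"
  assumes "linear T"
  obtains C where "C \<ge> 0" "\<And>x. \<exists>a. norm (x - a) \<le> norm x / 2 \<and> norm (T a) \<le> C * norm x"
proof -
  interpret linear T by fact
  define A where "A n = {x. norm (T x) \<le> real n}" for n
  have mid: "(1/2) *\<^sub>R (a - b) \<in> A n" if "a \<in> A n" "b \<in> A n" for a b n
    using that norm_triangle_ineq4[of "T a" "T b"] by (auto simp: A_def scale diff)
  have "\<exists>n. interior (closure (A n)) \<noteq> {}"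
  proof (rule ccontr)
    assume "\<nexists>n. interior (closure (A n)) \<noteq> {}"
    then have "euclidean interior_of \<Union>(range (\<lambda>n. closure (A n))) = {}"
      by (intro Baire_category_alt disjI1 completely_metrizable_space_euclidean) auto
    moreover have "\<Union>(range (\<lambda>n. closure (A n))) = UNIV"
    proof -
      have "x \<in> A (nat \<lceil>norm (T x)\<rceil>)" for x
        by (simp add: A_def)
      then show ?thesis using closure_subset by blast
    qed
    ultimately show False by simp
  qed
  then obtain n x0 r where "r > 0" and r: "ball x0 r \<subseteq> closure (A n)"
    by (metis all_not_in_conv mem_interior)
  have ball: "y \<in> closure (A n)" if "norm y < r" for y
  proof -
    \<comment> \<open>This is \<open>y\<close>, written as half the difference of two points of the
      ball around \<open>x0\<close>.\<close>
    have "(1/2) *\<^sub>R ((x0 + y) - (x0 - y)) \<in> closure (A n)"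
      by (rule closure_closed_under_binary[where g = "\<lambda>a b. (1/2) *\<^sub>R (a - b)"])
        (use that r mid in \<open>auto intro!: continuous_intros simp: dist_norm subset_eq\<close>)
    then show ?thesis by simp
  qed
  show thesis
  proof
    show "2 * real n / r \<ge> 0" using \<open>r > 0\<close> by simp
    fix x
    show "\<exists>a. norm (x - a) \<le> norm x / 2 \<and> norm (T a) \<le> (2 * real n / r) * norm x"
    proof (cases "x = 0")
      case True
      then show ?thesis by (intro exI[of _ 0]) (simp add: zero)
    next
      case False
      \<comment> \<open>\<open>s\<close> shrinks or stretches \<open>x\<close> to norm
        \<open>r / 2\<close>, inside the ball; an error below \<open>r / 4\<close> there becomes at
        most \<open>norm x / 2\<close> after dividing by \<open>s\<close>.\<close>
      define s where "s = r / (2 * norm x)"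
      have "s > 0" using False \<open>r > 0\<close> by (simp add: s_def)
      have "s *\<^sub>R x \<in> closure (A n)"
        by (rule ball) (use False \<open>r > 0\<close> in \<open>simp add: s_def\<close>)
      then obtain a where a: "a \<in> A n" "dist a (s *\<^sub>R x) < r / 4"
        using \<open>r > 0\<close> unfolding closure_approachable by (meson divide_pos_pos zero_less_numeral)
      define b where "b = (1/s) *\<^sub>R a"
      have "x - b = (1/s) *\<^sub>R (s *\<^sub>R x - a)"
        using \<open>s > 0\<close> by (simp add: b_def scaleR_diff_right)
      then have "norm (x - b) = norm (s *\<^sub>R x - a) / s"
        using \<open>s > 0\<close> by simp
      also have "\<dots> \<le> (r/4) / s"
        using a(2) \<open>s > 0\<close> by (intro divide_right_mono) (auto simp: dist_norm norm_minus_commute)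
      also have "\<dots> = norm x / 2"
        using \<open>r > 0\<close> False by (simp add: s_def field_simps)
      finally have 1: "norm (x - b) \<le> norm x / 2" .
      have "norm (T b) = norm (T a) / s"
        using \<open>s > 0\<close> by (simp add: b_def scale)
      also have "\<dots> \<le> real n / s"
        using a(1) \<open>s > 0\<close> by (intro divide_right_mono) (auto simp: A_def)
      also have "\<dots> = (2 * real n / r) * norm x"
        by (simp add: s_def)
      finally show ?thesis using 1 by blast
    qed
  qed
qed

text \<open>Each approximation halves the remainder, so the images of the approximants form an
  absolutely convergent series. Closedness of the graph identifies its sum with
  \<open>T x\<close>.\<close>

theorem closed_graph_bounded:
  fixes T :: "'a::banach \<Rightarrow> 'b::banach"
  assumes T: "linear T" and closed: "closed {(x, T x) |x. True}"
  shows "\<exists>K. \<forall>x. norm (T x) \<le> K * norm x"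
proof -
  interpret linear T by fact
  obtain C where "C \<ge> 0" and C: "\<exists>a. norm (x - a) \<le> norm x / 2 \<and> norm (T a) \<le> C * norm x" for x
    using closed_graph_approximation[OF T] by blast
  then obtain a where a: "norm (x - a x) \<le> norm x / 2" "norm (T (a x)) \<le> C * norm x" for x
    by metis
  have "norm (T x) \<le> 2 * C * norm x" for x
  proof -
    \<comment> \<open>The remainders of the successive approximation \<open>x = a x + a (x - a x) + \<dots>\<close>.\<close>
    define r where "r n = ((\<lambda>x. x - a x) ^^ n) x" for n
    have r: "norm (r n) \<le> norm x * (1/2) ^ n" for n
    proof (induction n)
      case (Suc n)
      then show ?case using a(1)[of "r n"] by (simp add: r_def)
    qed (simp add: r_def)
    have Ta: "norm (T (a (r n))) \<le> C * norm x * (1/2) ^ n" for n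
      using a(2)[of "r n"] mult_left_mono[OF r[of n] \<open>C \<ge> 0\<close>] by (simp add: mult.assoc)
    have sums: "(\<lambda>n. C * norm x * (1/2) ^ n) sums (C * norm x * 2)"
      using sums_mult[OF geometric_sums[of "1/2 :: real"], of "C * norm x"] by simp
    have norm_summable: "summable (\<lambda>n. norm (T (a (r n))))"
      by (rule summable_comparison_test'[OF sums_summable[OF sums]]) (use Ta in simp)
    \<comment> \<open>Telescoping: \<open>a (r k) = r k - r (Suc k)\<close> and
      \<open>r 0 = x\<close>.\<close>
    have partial: "(\<Sum>k<n. a (r k)) = x - r n" for n
      by (induction n) (simp_all add: r_def)
    have "r \<longlonglongrightarrow> 0"
    proof (rule Lim_null_comparison)
      show "(\<lambda>n. norm x * (1/2) ^ n) \<longlonglongrightarrow> 0"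
        by (intro tendsto_mult_right_zero LIMSEQ_power_zero) simp
    qed (use r in simp)
    then have "(\<lambda>n. \<Sum>k<n. a (r k)) \<longlonglongrightarrow> x"
      unfolding partial using tendsto_diff[OF tendsto_const, of r 0 _ x] by simp
    moreover have "(\<lambda>n. T (\<Sum>k<n. a (r k))) \<longlonglongrightarrow> (\<Sum>k. T (a (r k)))"
      using summable_LIMSEQ[OF summable_norm_cancel[OF norm_summable]] by (simp add: sum)
    ultimately have "(\<lambda>n. ((\<Sum>k<n. a (r k)), T (\<Sum>k<n. a (r k)))) \<longlonglongrightarrow> (x, \<Sum>k. T (a (r k)))"
      by (rule tendsto_Pair)
    then have "(x, \<Sum>k. T (a (r k))) \<in> {(x, T x) |x. True}"
      by (rule closed_sequentially[OF closed, rotated]) auto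
    then have "norm (T x) = norm (\<Sum>k. T (a (r k)))"
      by auto
    also have "\<dots> \<le> (\<Sum>k. norm (T (a (r k))))"
      by (rule summable_norm[OF norm_summable])
    also have "\<dots> \<le> C * norm x * 2"
      using suminf_le[OF Ta norm_summable sums_summable[OF sums]] sums_unique[OF sums] by simp
    finally show ?thesis by (simp add: mult_ac)
  qed
  then show ?thesis by blast
qed

section \<open>Complex linear operators\<close>

lemma cbounded_linear_iff:
  "cbounded_linear T \<longleftrightarrow> bounded_linear T \<and> (\<forall>a x. T (a *\<^sub>C x) = a *\<^sub>C T x)"
proof
  assume T: "cbounded_linear T"
  then obtain K where "norm (T x) \<le> norm x * K" for x
    by (auto simp: cbounded_linear_def mult.commute)
  with T show "bounded_linear T \<and> (\<forall>a x. T (a *\<^sub>C x) = a *\<^sub>C T x)"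
    by (auto simp: cbounded_linear_def clinear_on_def simp flip: scaleC_of_real
        intro!: bounded_linear_intro[where K = K])
next
  assume T: "bounded_linear T \<and> (\<forall>a x. T (a *\<^sub>C x) = a *\<^sub>C T x)"
  then interpret bounded_linear T by simp
  obtain K where "norm (T x) \<le> norm x * K" for x
    using bounded by blast
  with T show "cbounded_linear T"
    by (auto simp: cbounded_linear_def clinear_on_def csubspace_def add mult.commute)
qed

lemma cbounded_linear_compose:
  "cbounded_linear f \<Longrightarrow> cbounded_linear g \<Longrightarrow> cbounded_linear (\<lambda>x. f (g x))"
  by (auto simp: cbounded_linear_iff intro: bounded_linear_compose)

lemma clinear_on_UNIV_simps:
  assumes "clinear_on UNIV T"
  shows "T (x + y) = T x + T y" "T (a *\<^sub>C x) = a *\<^sub>C T x" "T (x - y) = T x - T y" "T 0 = 0"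
  using assms clinear_on_diff[OF assms, of x y] clinear_on_diff[OF assms, of 0 0]
  by (auto simp: clinear_on_def)

lemma scaleC_diff_right: "a *\<^sub>C (x - y) = a *\<^sub>C x - a *\<^sub>C (y::'a::complex_vector)"
  using scaleC_add_right[of a "x - y" y] by simp

lemma scaleC_diff_left: "(a - b) *\<^sub>C x = a *\<^sub>C x - b *\<^sub>C (x::'a::complex_vector)"
  using scaleC_add_left[of "a - b" b x] by simp

lemma scaleC_Pair: "a *\<^sub>C (x, y) = (a *\<^sub>C x, a *\<^sub>C y)"
  by (simp add: scaleC_prod_def)

lemma cbounded_linear_pencil:
  assumes "cbounded_linear E" "cbounded_linear A"
  shows "cbounded_linear (pencil E A l)"
proof -
  have "bounded_linear ((*\<^sub>C) l :: 'b \<Rightarrow> 'b)"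
    by (rule bounded_linear_intro[where K = "cmod l"])
      (simp_all add: scaleC_add_right norm_scaleC scaleC_scaleC mult.commute flip: scaleC_of_real)
  then show ?thesis
    using assms by (auto simp: cbounded_linear_iff pencil_def[abs_def] scaleC_diff_right scaleC_scaleC
        mult.commute intro!: bounded_linear_sub bounded_linear_compose[where f = "(*\<^sub>C) l"])
qed

lemma cbounded_linear_closed_graph:
  fixes T :: "'a::cbanach \<Rightarrow> 'b::cbanach"
  assumes T: "clinear_on UNIV T" and closed: "closed_operator UNIV T"
  shows "cbounded_linear T"
proof -
  have "linear T"
    using T by (intro linearI) (simp_all add: clinear_on_def flip: scaleC_of_real)
  then show ?thesis
    using T closed closed_graph_bounded[of T] by (simp add: closed_operator_def cbounded_linear_def)
qed

lemma continuous_wrt_bound: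
  assumes T: "clinear_on D T" and bound: "\<And>x. x \<in> D \<Longrightarrow> norm (T x) \<le> K * N x"
    and "K \<ge> 0"
  shows "continuous_wrt D N T"
  unfolding continuous_wrt_def
proof (intro ballI allI impI)
  fix x and e :: real assume "x \<in> D" "e > 0"
  \<comment> \<open>Dividing by \<open>K + 1\<close> also covers \<open>K = 0\<close>.\<close>
  have "norm (T y - T x) < e" if "y \<in> D" "N (y - x) < e / (K + 1)" for y
  proof -
    have "y - x \<in> D" and "T (y - x) = T y - T x"
      using clinear_on_diff[OF T] that(1) \<open>x \<in> D\<close> by auto
    then have "norm (T y - T x) \<le> K * N (y - x)"
      using bound[of "y - x"] by simp
    also have "\<dots> \<le> K * (e / (K + 1))"
      using that(2) \<open>K \<ge> 0\<close> by (intro mult_left_mono) auto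
    also have "\<dots> < e"
      using \<open>e > 0\<close> \<open>K \<ge> 0\<close> by (simp add: field_simps)
    finally show ?thesis .
  qed
  then show "\<exists>d>0. \<forall>y\<in>D. N (y - x) < d \<longrightarrow> norm (T y - T x) < e"
    using \<open>e > 0\<close> \<open>K \<ge> 0\<close> by (intro exI[of _ "e / (K + 1)"]) auto
qed

lemma boundedly_invertibleI:
  assumes "cbounded_linear T" "cbounded_linear V" "\<And>x. V (T x) = x" "\<And>y. T (V y) = y"
  shows "boundedly_invertible T"
proof -
  have "bij T"
    using assms(3,4) by (intro o_bij[of V]) auto
  moreover have "inv T = V"
    using assms(3,4) by (intro inv_equality) auto
  ultimately show ?thesis
    using assms by (simp add: boundedly_invertible_def)
qed

text \<open>Changing the sign of \<open>K\<close> gives the inverse.\<close>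

lemma boundedly_invertible_shear:
  fixes K :: "'u::complex_normed_vector \<Rightarrow> 'x::complex_normed_vector"
  assumes K: "cbounded_linear K"
  shows "boundedly_invertible (\<lambda>(x, u). (x - K u, u))"
proof (rule boundedly_invertibleI)
  have "bounded_linear (\<lambda>p::'x \<times> 'u. K (snd p))"
    using K by (auto simp: cbounded_linear_iff intro: bounded_linear_compose bounded_linear_snd)
  then show "cbounded_linear (\<lambda>(x, u). (x - K u, u))" "cbounded_linear (\<lambda>(x, u). (x + K u, u))"
    using K by (auto simp: cbounded_linear_iff case_prod_unfold scaleC_prod_def scaleC_diff_right
        scaleC_add_right intro!: bounded_linear_Pair bounded_linear_sub bounded_linear_add
        bounded_linear_fst bounded_linear_snd)
qed auto

lemma bij_betw_preimage:
  assumes "bij f" and iff: "\<And>x. x \<in> A \<longleftrightarrow> f x \<in> B"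
  shows "bij_betw f A B"
proof (rule bij_betw_imageI)
  show "inj_on f A"
    using bij_is_inj[OF assms(1)] by (rule inj_on_subset) simp
  show "f ` A = B"
    using bij_is_surj[OF assms(1)] iff by (auto simp: image_iff) (metis surjD)
qed

section \<open>Operator nodes\<close>

locale node_with_extrapolation =
  fixes D :: "('x::chilbert_space \<times> 'u::chilbert_space) set"
    and S :: "'x \<times> 'u \<Rightarrow> 'z::chilbert_space \<times> 'y::chilbert_space"
    and E :: "'x \<Rightarrow> 'z"
    and \<mu> :: complex
    and \<iota> :: "'z \<Rightarrow> 'w::cbanach"
  assumes node: "operator_node D S E"
    and mu: "\<mu> \<in> resolvent_set E (main_dom D) (main_op S)"
    and Zm1: "is_Zm1 D S E \<mu> \<iota>"
begin

section \<open>The resolvent and the embedding of \<open>Z\<close> into its extrapolation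
  space\<close>

abbreviation "\<rho> \<equiv> resolvent_set E (main_dom D) (main_op S)"
abbreviation "R \<equiv> resolvent E (main_dom D) (main_op S)"
abbreviation "T \<equiv> pencil (\<iota> \<circ> E) (Am1 D S \<iota>)"

lemma S_linear: "clinear_on D S"
  and E_bounded: "cbounded_linear E"
  and main_linear: "clinear_on (main_dom D) (main_op S)"
  and dense: "closure (main_dom D) = UNIV"
  using node main_dom_clinear by (auto simp: operator_node_def)

lemmas E_simps = clinear_on_UNIV_simps[OF conjunct1[OF E_bounded[unfolded cbounded_linear_def]]]

lemma iota_linear: "clinear_on UNIV \<iota>"
  and norm_iota: "norm (\<iota> z) = norm (R \<mu> z)"
  and iota_dense: "closure (range \<iota>) = UNIV"
  using Zm1 by (auto simp: is_Zm1_def is_completion_def)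

lemmas iota_simps = clinear_on_UNIV_simps[OF iota_linear]

lemma R_bounded: "l \<in> \<rho> \<Longrightarrow> cbounded_linear (R l)"
  by (simp add: resolvent_set_def)

lemma R_simps:
  assumes "l \<in> \<rho>"
  shows "R l (x + y) = R l x + R l y" "R l (a *\<^sub>C x) = a *\<^sub>C R l x" "R l (x - y) = R l x - R l y"
    "R l 0 = 0"
  using R_bounded[OF assms] clinear_on_UNIV_simps by (auto simp: cbounded_linear_def)

lemma R_pencil: "l \<in> \<rho> \<Longrightarrow> x \<in> main_dom D \<Longrightarrow> R l (pencil E (main_op S) l x) = x"
  by (auto simp: resolvent_set_def resolvent_def bij_betw_def)

lemma pencil_R: "l \<in> \<rho> \<Longrightarrow> pencil E (main_op S) l (R l z) = z"
  and R_in_dom: "l \<in> \<rho> \<Longrightarrow> R l z \<in> main_dom D"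
  by (auto simp: resolvent_set_def resolvent_def bij_betw_def intro: f_inv_into_f inv_into_into)

text \<open>The norm of \<open>\<iota> z\<close> is that of \<open>R \<mu> z\<close>, and
  \<open>R \<mu>\<close> has trivial kernel because the pencil inverts it.\<close>

lemma inj_iota: "inj \<iota>"
proof (rule injI)
  fix x y assume "\<iota> x = \<iota> y"
  then have "norm (\<iota> (x - y)) = 0"
    by (simp add: iota_simps)
  then have "R \<mu> (x - y) = 0"
    by (simp add: norm_iota)
  then have "x - y = pencil E (main_op S) \<mu> 0"
    using pencil_R[OF mu, of "x - y"] by simp
  also have "\<dots> = 0"
    using clinear_on_diff[OF main_linear, of 0 0] main_linear E_simps(4)
    by (auto simp: pencil_def clinear_on_def csubspace_def)
  finally show "x = y" by simp
qed

lemma Am1_bounded: "cbounded_linear (Am1 D S \<iota>)"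
  and Am1_main: "x \<in> main_dom D \<Longrightarrow> Am1 D S \<iota> x = \<iota> (main_op S x)"
  using theI'[OF Am1_exists_unique[OF node mu Zm1]] by (simp_all add: Am1_def)

lemmas Am1_simps = clinear_on_UNIV_simps[OF conjunct1[OF Am1_bounded[unfolded cbounded_linear_def]]]

section \<open>The extended pencil as an isomorphism of \<open>X\<close> onto the extrapolation
  space\<close>

text \<open>Apply \<open>R l\<close> to the pencil at \<open>l\<close> evaluated in
  \<open>R \<mu> z\<close>, which equals \<open>z\<close> plus \<open>l - \<mu>\<close> times
  \<open>E (R \<mu> z)\<close>.\<close>

lemma resolvent_identity:
  assumes "l \<in> \<rho>"
  shows "R l z = R \<mu> z - (l - \<mu>) *\<^sub>C R l (E (R \<mu> z))"
proof -
  let ?x = "R \<mu> z"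
  have "pencil E (main_op S) l ?x = pencil E (main_op S) \<mu> ?x + (l - \<mu>) *\<^sub>C E ?x"
    by (simp add: pencil_def scaleC_diff_left)
  then have "pencil E (main_op S) l ?x = z + (l - \<mu>) *\<^sub>C E ?x"
    by (simp add: pencil_R mu)
  then have "R l (z + (l - \<mu>) *\<^sub>C E ?x) = ?x"
    using R_pencil[OF assms R_in_dom[OF mu, of z]] by simp
  then show ?thesis
    by (simp add: R_simps[OF assms] algebra_simps)
qed

lemma iota_bounded: "cbounded_linear \<iota>"
  using R_bounded[OF mu] iota_linear by (simp add: cbounded_linear_def norm_iota)

lemma T_bounded: "cbounded_linear (T l)"
  using cbounded_linear_compose[OF iota_bounded E_bounded] Am1_bounded
  by (intro cbounded_linear_pencil) (simp_all add: o_def)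

lemma T_main: "x \<in> main_dom D \<Longrightarrow> T l x = \<iota> (pencil E (main_op S) l x)"
  by (simp add: pencil_def Am1_main iota_simps)

text \<open>The first resolvent identity compares \<open>R l z\<close> with \<open>R \<mu> z\<close>, whose norm is that of \<open>\<iota> z\<close>.\<close>

lemma resolvent_extension:
  assumes l: "l \<in> \<rho>"
  obtains V where "cbounded_linear V" "\<And>z. V (\<iota> z) = R l z"
proof -
  have "bounded_linear (\<lambda>x. R l (E x))"
    using cbounded_linear_compose[OF R_bounded[OF l] E_bounded] by (simp add: cbounded_linear_iff)
  then obtain K where K: "norm (R l (E x)) \<le> norm x * K" for x
    using bounded_linear.bounded by blast
  have bound: "norm (R l z) \<le> (1 + cmod (l - \<mu>) * K) * norm (\<iota> z)" for z
  proof -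
    have "norm (R l z) \<le> norm (R \<mu> z) + cmod (l - \<mu>) * norm (R l (E (R \<mu> z)))"
      using norm_triangle_ineq4[of "R \<mu> z" "(l - \<mu>) *\<^sub>C R l (E (R \<mu> z))"]
      by (simp add: norm_scaleC flip: resolvent_identity[OF l])
    also have "\<dots> \<le> norm (R \<mu> z) + cmod (l - \<mu>) * (norm (R \<mu> z) * K)"
      using K by (intro add_left_mono mult_left_mono) auto
    finally show ?thesis
      by (simp add: norm_iota algebra_simps)
  qed
  have inv: "inv \<iota> (\<iota> z) = z" for z
    by (simp add: inj_iota)
  \<comment> \<open>\<open>R l\<close> is transported to the dense subspace
    \<open>range \<iota>\<close>; the bound above then lets it extend to the whole space.\<close>
  have lin: "clinear_on (range \<iota>) (\<lambda>w. R l (inv \<iota> w))"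
    using iota_simps(4)[symmetric]
    by (auto simp: clinear_on_def csubspace_def R_simps[OF l] inv simp flip: iota_simps(1,2))
  have "\<exists>V. cbounded_linear V \<and> (\<forall>w\<in>range \<iota>. V w = R l (inv \<iota> w))"
    using ex1_implies_ex[OF bounded_extension_exists_unique[OF lin iota_dense]] bound inv by fastforce
  with inv that show thesis by auto
qed

text \<open>The inverse is the extension \<open>V\<close> of \<open>R l\<close>. Both compositions
  are continuous and are the identity on a dense set: \<open>main_dom D\<close> on one side,
  \<open>range \<iota>\<close> on the other.\<close>

lemma T_invertible:
  assumes l: "l \<in> \<rho>"
  shows "boundedly_invertible (T l)"
proof -
  obtain V where V: "cbounded_linear V" "\<And>z. V (\<iota> z) = R l z"
    using resolvent_extension[OF l] by blast
  have "V (T l x) = x" for x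
    by (rule continuous_eq_on_dense[OF dense, where f = "\<lambda>x. V (T l x)"])
      (auto simp: T_main V(2) R_pencil[OF l]
        intro: cbounded_linear_continuous_on cbounded_linear_compose[OF V(1) T_bounded])
  moreover have "T l (V w) = w" for w
    by (rule continuous_eq_on_dense[OF iota_dense, where f = "\<lambda>w. T l (V w)"])
      (auto simp: T_main V(2) pencil_R[OF l] R_in_dom[OF l]
        intro: cbounded_linear_continuous_on cbounded_linear_compose[OF T_bounded V(1)])
  ultimately show ?thesis
    using boundedly_invertibleI T_bounded V(1) by blast
qed

text \<open>If \<open>T l x = \<iota> z\<close>, then \<open>R l z\<close> has the same image under
  the injective \<open>T l\<close>, so \<open>x\<close> is \<open>R l z\<close>.\<close>

lemma T_in_range_iota_iff:
  assumes l: "l \<in> \<rho>"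
  shows "T l x \<in> range \<iota> \<longleftrightarrow> x \<in> main_dom D"
proof
  assume "T l x \<in> range \<iota>"
  then obtain z where "T l x = \<iota> z" by auto
  also have "\<dots> = T l (R l z)"
    by (simp add: T_main pencil_R R_in_dom l)
  finally have "x = R l z"
    using T_invertible[OF l] by (auto simp: boundedly_invertible_def bij_def dest: injD)
  then show "x \<in> main_dom D"
    by (simp add: R_in_dom l)
qed (simp add: T_main)

section \<open>The bounded solution operator of A&B (x, u) = \<mu> E x - z\<close>

lemma D_add: "p \<in> D \<Longrightarrow> q \<in> D \<Longrightarrow> p + q \<in> D" "p \<in> D \<Longrightarrow> q \<in> D \<Longrightarrow> S (p + q) = S p + S q"
  and D_scale: "p \<in> D \<Longrightarrow> a *\<^sub>C p \<in> D" "p \<in> D \<Longrightarrow> S (a *\<^sub>C p) = a *\<^sub>C S p"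
  using S_linear by (auto simp: clinear_on_def csubspace_def)

lemma solution_exists:
  "\<exists>x y. (x, u) \<in> D \<and> S (x, u) = (\<mu> *\<^sub>C E x - z, y)"
proof -
  obtain x0 where x0: "(x0, u) \<in> D"
    using node by (auto simp: operator_node_def)
  \<comment> \<open>Some \<open>x0\<close> fits the input \<open>u\<close>. The correction
    \<open>r\<close> in dom A is chosen so that \<mu> E r - A r cancels the defect of
    \<open>x0\<close> in the equation.\<close>
  define r where "r = R \<mu> (z - \<mu> *\<^sub>C E x0 + fst (S (x0, u)))"
  have r: "(r, 0) \<in> D" "\<mu> *\<^sub>C E r - fst (S (r, 0)) = z - \<mu> *\<^sub>C E x0 + fst (S (x0, u))"
    using R_in_dom[OF mu] pencil_R[OF mu] by (auto simp: r_def main_dom_def pencil_def main_op_def)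
  have "(x0 + r, u) \<in> D" "S (x0 + r, u) = S (x0, u) + S (r, 0)"
    using D_add[OF x0 r(1)] by simp_all
  moreover have "fst (S (x0, u)) + fst (S (r, 0)) = \<mu> *\<^sub>C E (x0 + r) - z"
    using r(2) by (simp add: E_simps scaleC_add_right algebra_simps)
  ultimately show ?thesis
    by (metis fst_add prod.collapse)
qed

text \<open>The difference of two solutions has input 0 and lies in the kernel of \<mu> E -
  A.\<close>

lemma solution_unique:
  assumes "(x, u) \<in> D" "S (x, u) = (\<mu> *\<^sub>C E x - z, y)"
    and "(x', u) \<in> D" "S (x', u) = (\<mu> *\<^sub>C E x' - z, y')"
  shows "x = x' \<and> y = y'"
proof -
  have *: "(x - x', 0) \<in> D" "S (x - x', 0) = (\<mu> *\<^sub>C E (x - x'), y - y')"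
    using clinear_on_diff[OF S_linear assms(1,3)] assms(2,4)
    by (simp_all add: E_simps scaleC_diff_right)
  then have "x - x' = R \<mu> 0"
    using R_pencil[OF mu, of "x - x'"] by (simp add: main_dom_def pencil_def main_op_def)
  then have "x = x'"
    by (simp add: R_simps[OF mu])
  with assms show ?thesis by simp
qed

text \<open>Uniqueness makes \<open>Q\<close> linear. Closedness of \<open>S\<close> makes its graph
  closed, so the closed graph theorem applies.\<close>

lemma solution_operator:
  obtains Q :: "'z \<times> 'u \<Rightarrow> 'x \<times> 'y"
  where "cbounded_linear Q"
    "\<And>z u x y. Q (z, u) = (x, y) \<longleftrightarrow> (x, u) \<in> D \<and> S (x, u) = (\<mu> *\<^sub>C E x - z, y)"
proof -
  have "\<forall>q. \<exists>r. (fst r, snd q) \<in> D \<and> S (fst r, snd q) = (\<mu> *\<^sub>C E (fst r) - fst q, snd r)"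
    using solution_exists by simp
  then obtain Q where Q: "(fst (Q q), snd q) \<in> D"
      "S (fst (Q q), snd q) = (\<mu> *\<^sub>C E (fst (Q q)) - fst q, snd (Q q))" for q
    by metis
  \<comment> \<open>As an equivalence, this reduces linearity of \<open>Q\<close> to checking that
    the proposed value solves the equation.\<close>
  have char: "Q q = r \<longleftrightarrow> (fst r, snd q) \<in> D \<and> S (fst r, snd q) = (\<mu> *\<^sub>C E (fst r) - fst q, snd r)"
    for q r
    using Q[of q] solution_unique[of "fst r" "snd q" "fst q" "snd r" "fst (Q q)" "snd (Q q)"]
    by (auto simp: prod_eq_iff)
  have "Q (p + q) = Q p + Q q" for p q
    using D_add[OF Q(1)[of p] Q(1)[of q]] Q(2)[of p] Q(2)[of q]
    by (simp add: char E_simps scaleC_add_right)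
  moreover have "Q (a *\<^sub>C p) = a *\<^sub>C Q p" for a p
    using D_scale[OF Q(1)[of p], of a] Q(2)[of p]
    by (simp add: char E_simps scaleC_diff_right scaleC_prod_def scaleC_scaleC mult.commute)
  ultimately have "clinear_on UNIV Q"
    by (simp add: clinear_on_def csubspace_def)
  moreover have "closed_operator UNIV Q"
  proof -
    \<comment> \<open>\<open>?g\<close> sends a candidate pair \<open>(q, r)\<close> to the point
      that lies on the graph of \<open>S\<close> exactly if \<open>r = Q q\<close>.\<close>
    let ?g = "\<lambda>(q, r). ((fst r, snd q), (\<mu> *\<^sub>C E (fst r) - fst q, snd r))"
    have eq: "{(q, Q q) |q. q \<in> UNIV} = ?g -` {(p, S p) |p. p \<in> D}"
      using char by (auto simp: eq_commute)
    have "continuous_on UNIV ?g"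
      unfolding case_prod_unfold
      by (intro continuous_intros continuous_on_compose2[OF cbounded_linear_continuous_on[OF E_bounded]]) auto
    moreover have "closed {(p, S p) |p. p \<in> D}"
      using node by (simp add: operator_node_def closed_operator_def)
    ultimately show ?thesis
      unfolding closed_operator_def eq by (intro closed_vimage)
  qed
  ultimately have "cbounded_linear Q"
    by (rule cbounded_linear_closed_graph)
  then show thesis
    using that char by simp
qed

section \<open>The control operator\<close>

lemma iota_diff_in_range_iff: "\<iota> z - w \<in> range \<iota> \<longleftrightarrow> w \<in> range \<iota>"
proof
  assume "\<iota> z - w \<in> range \<iota>"
  then obtain z' where "\<iota> z - w = \<iota> z'" by auto
  then have "w = \<iota> (z - z')"
    by (simp add: iota_simps algebra_simps)
  then show "w \<in> range \<iota>" by simp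
next
  assume "w \<in> range \<iota>"
  then obtain z' where "w = \<iota> z'" by auto
  then have "\<iota> z - w = \<iota> (z - z')"
    by (simp add: iota_simps)
  then show "\<iota> z - w \<in> range \<iota>" by simp
qed

text \<open>Every \<open>u\<close> occurs in some pair of \<open>D\<close>, and the extension
  property at that pair forces the value \<open>B u\<close>.\<close>

lemma control_op_unique:
  assumes "is_control_op D S \<iota> B" "is_control_op D S \<iota> B'"
  shows "B = B'"
proof
  fix u
  obtain x where x: "(x, u) \<in> D"
    using solution_exists by blast
  have "Am1 D S \<iota> x + B u = \<iota> (AB S (x, u))" "Am1 D S \<iota> x + B' u = \<iota> (AB S (x, u))"
    using assms x by (auto simp: is_control_op_def)
  then show "B u = B' u"
    by (metis add_left_cancel)
qed

lemma control_op_exists: "\<exists>B. is_control_op D S \<iota> B"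
proof -
  obtain Q where Q: "cbounded_linear Q"
    "\<And>z u x y. Q (z, u) = (x, y) \<longleftrightarrow> (x, u) \<in> D \<and> S (x, u) = (\<mu> *\<^sub>C E x - z, y)"
    using solution_operator by blast
  \<comment> \<open>With \<open>z = 0\<close>, A&B (G u, u) is \<mu> E (G u). The extension property
    at \<open>(G u, u)\<close> therefore forces \<open>B u = T \<mu> (G u)\<close>.\<close>
  define G where "G u = fst (Q (0, u))" for u
  have G: "(G u, u) \<in> D" "fst (S (G u, u)) = \<mu> *\<^sub>C E (G u)" for u
    using Q(2)[of 0 u "fst (Q (0, u))" "snd (Q (0, u))"] by (simp_all add: G_def)
  have "bounded_linear (\<lambda>u. fst (Q (0, u)))"
    using Q(1) by (auto simp: cbounded_linear_iff intro!: bounded_linear_compose[OF bounded_linear_fst]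
        bounded_linear_compose[of Q] bounded_linear_Pair bounded_linear_zero bounded_linear_ident)
  moreover have "fst (Q (0, a *\<^sub>C u)) = a *\<^sub>C fst (Q (0, u))" for a u
  proof -
    have "Q (0, a *\<^sub>C u) = Q (a *\<^sub>C (0, u))"
      by (simp add: scaleC_prod_def)
    also have "\<dots> = a *\<^sub>C Q (0, u)"
      using Q(1) by (simp add: cbounded_linear_iff)
    finally show ?thesis by (simp add: scaleC_prod_def)
  qed
  ultimately have "cbounded_linear G"
    by (simp add: cbounded_linear_iff G_def[abs_def])
  then have "cbounded_linear (\<lambda>u. T \<mu> (G u))"
    by (rule cbounded_linear_compose[OF T_bounded])
  \<comment> \<open>Subtracting \<open>(G u, u)\<close> from \<open>(x, u)\<close> leaves a pair
    with input 0.\<close>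
  moreover have D_iff: "(x, u) \<in> D \<longleftrightarrow> x - G u \<in> main_dom D" for x u
    using D_add(1)[OF G(1)[of u], of "(x - G u, 0)"]
      clinear_on_diff[OF S_linear _ G(1)[of u], of "(x, u)"] by (auto simp: main_dom_def)
  \<comment> \<open>The first term on the right lies in \<open>range \<iota>\<close>, so membership
    of the left side is decided by \<open>T \<mu> (x - G u)\<close>, that is, by
    \<open>x - G u\<close> lying in dom A.\<close>
  have sum: "Am1 D S \<iota> x + T \<mu> (G u) = \<iota> (\<mu> *\<^sub>C E x) - T \<mu> (x - G u)" for x u
    by (simp add: pencil_def Am1_simps E_simps iota_simps scaleC_diff_right)
  moreover have "Am1 D S \<iota> x + T \<mu> (G u) = \<iota> (AB S (x, u))" if "(x, u) \<in> D" for x u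
  proof -
    have *: "x - G u \<in> main_dom D"
      using that D_iff by simp
    moreover have "main_op S (x - G u) = fst (S (x, u)) - \<mu> *\<^sub>C E (G u)"
      using clinear_on_diff[OF S_linear that G(1)[of u]] G(2)[of u] by (simp add: main_op_def)
    ultimately have "pencil E (main_op S) \<mu> (x - G u) = \<mu> *\<^sub>C E x - fst (S (x, u))"
      by (simp add: pencil_def E_simps scaleC_diff_right)
    then show ?thesis
      unfolding sum T_main[OF *] by (simp add: iota_simps(3) AB_def)
  qed
  moreover have "Am1 D S \<iota> x + T \<mu> (G u) \<in> range \<iota> \<longleftrightarrow> (x, u) \<in> D" for x u
    unfolding sum iota_diff_in_range_iff by (simp add: D_iff T_in_range_iota_iff mu)
  ultimately show ?thesis
    unfolding is_control_op_def by (intro exI[of _ "\<lambda>u. T \<mu> (G u)"]) auto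
qed

section \<open>Continuity of C&D and of C\<close>

text \<open>The components of \<open>p\<close> solve the equation with \<open>z\<close> read off
  from A&B. Thus C&D depends on \<open>p\<close> and \<open>AB S p\<close> alone, through
  \<open>Q\<close>.\<close>

lemma CD_eq_solution:
  fixes Q :: "'z \<times> 'u \<Rightarrow> 'x \<times> 'y"
  assumes "\<And>z u x y. Q (z, u) = (x, y) \<longleftrightarrow> (x, u) \<in> D \<and> S (x, u) = (\<mu> *\<^sub>C E x - z, y)"
    and "p \<in> D"
  shows "CD S p = snd (Q (\<mu> *\<^sub>C E (fst p) - AB S p, snd p))"
proof -
  have "Q (\<mu> *\<^sub>C E (fst p) - AB S p, snd p) = (fst p, CD S p)"
    using assms by (simp add: AB_def CD_def)
  then show ?thesis by simp
qed

lemma CD_linear: "clinear_on D (CD S)"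
  using S_linear by (simp add: clinear_on_def CD_def scaleC_prod_def)

text \<open>C&D is a component of \<open>S\<close>, so the graph norm of \<open>S\<close> dominates
  it directly.\<close>

lemma CD_continuous_S: "continuous_wrt D (graph_norm S) (CD S)"
proof (rule continuous_wrt_bound[OF CD_linear])
  show "norm (CD S p) \<le> 1 * graph_norm S p" for p
    using norm_snd_le[of "snd (S p)" "fst (S p)"]
      norm_snd_le[of "S p" p]
    by (simp add: CD_def graph_norm_def)
qed simp

text \<open>This graph norm leaves out the output C&D p, and is thus the smaller one; the estimate
  comes from the boundedness of \<open>Q\<close>.\<close>

lemma CD_continuous_AB: "continuous_wrt D (graph_norm (AB S)) (CD S)"
proof -
  obtain Q where Q: "cbounded_linear Q"
    "\<And>z u x y. Q (z, u) = (x, y) \<longleftrightarrow> (x, u) \<in> D \<and> S (x, u) = (\<mu> *\<^sub>C E x - z, y)"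
    using solution_operator by blast
  \<comment> \<open>\<open>H\<close> is bounded on the whole product space and takes the value
    \<open>CD S p\<close> at the graph point \<open>(p, AB S p)\<close>.\<close>
  define H where "H = (\<lambda>(p, z). snd (Q (\<mu> *\<^sub>C E (fst p) - z, snd p)))"
  have "bounded_linear (\<lambda>x. \<mu> *\<^sub>C E x)"
    using cbounded_linear_pencil[OF E_bounded, of "\<lambda>_. 0" \<mu>]
    by (simp add: cbounded_linear_iff pencil_def[abs_def])
  then have "bounded_linear (\<lambda>r::('x \<times> 'u) \<times> 'z. \<mu> *\<^sub>C E (fst (fst r)))"
    by (rule bounded_linear_compose[OF _ bounded_linear_compose[OF bounded_linear_fst bounded_linear_fst]])
  then have "bounded_linear (\<lambda>r::('x \<times> 'u) \<times> 'z. (\<mu> *\<^sub>C E (fst (fst r)) - snd r, snd (fst r)))"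
    by (rule bounded_linear_Pair[OF bounded_linear_sub[OF _ bounded_linear_snd]
          bounded_linear_compose[OF bounded_linear_snd bounded_linear_fst]])
  moreover have "bounded_linear (\<lambda>q. snd (Q q))"
    using Q(1) bounded_linear_compose[OF bounded_linear_snd, of Q] by (simp add: cbounded_linear_iff)
  ultimately have "bounded_linear H"
    unfolding H_def case_prod_unfold by (rule bounded_linear_compose[rotated])
  then obtain K where "K \<ge> 0" and K: "\<And>r. norm (H r) \<le> norm r * K"
    using bounded_linear.nonneg_bounded by blast
  have "norm (CD S p) \<le> K * graph_norm (AB S) p" if "p \<in> D" for p
    using K[of "(p, AB S p)"] CD_eq_solution[OF Q(2) that]
    by (simp add: H_def graph_norm_def mult.commute)
  then show ?thesis
    using continuous_wrt_bound[OF CD_linear] \<open>K \<ge> 0\<close> by blast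
qed

text \<open>For input 0 the argument of \<open>Q\<close> is the pencil value at \<open>x\<close>,
  whose norm is the norm of \<open>X_1\<close>, paired with 0.\<close>

lemma C_continuous: "continuous_wrt (main_dom D) (norm_X1 S E \<mu>) (\<lambda>x. CD S (x, 0))"
proof -
  obtain Q where Q: "cbounded_linear Q"
    "\<And>z u x y. Q (z, u) = (x, y) \<longleftrightarrow> (x, u) \<in> D \<and> S (x, u) = (\<mu> *\<^sub>C E x - z, y)"
    using solution_operator by blast
  obtain K where "K \<ge> 0" and K: "\<And>q. norm (Q q) \<le> norm q * K"
    using Q(1) bounded_linear.nonneg_bounded unfolding cbounded_linear_iff by blast
  have "clinear_on (main_dom D) (\<lambda>x. CD S (x, 0))"
    \<comment> \<open>\<open>main_op\<close> takes a first component, so C&D is placed there, next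
      to a dummy second component.\<close>
    using main_dom_clinear[of D "\<lambda>p. (CD S p, 0::complex)"] CD_linear
    by (simp add: clinear_on_def main_op_def[abs_def] scaleC_Pair)
  moreover have "norm (CD S (x, 0)) \<le> K * norm_X1 S E \<mu> x" if "x \<in> main_dom D" for x
  proof -
    let ?q = "(pencil E (main_op S) \<mu> x, 0::'u)"
    have "CD S (x, 0) = snd (Q ?q)"
      using CD_eq_solution[OF Q(2), of "(x, 0)"] that
      by (simp add: main_dom_def pencil_def main_op_def AB_def)
    then have "norm (CD S (x, 0)) \<le> norm (Q ?q)"
      using norm_snd_le[of "snd (Q ?q)" "fst (Q ?q)"] by simp
    also have "\<dots> \<le> norm ?q * K"
      by (rule K)
    finally show ?thesis
      by (simp add: norm_X1_def norm_Pair mult.commute)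
  qed
  ultimately show ?thesis
    using continuous_wrt_bound \<open>K \<ge> 0\<close> by blast
qed

section \<open>Inputs reaching the range of \<open>E\<close>, and the operators
  \<open>F_op\<close>\<close>

text \<open>The solution for \<open>z = 0\<close> works, as \<mu> E x is the image of a multiple of
  \<open>x\<close>.\<close>

lemma input_reaches_range_E: "\<exists>x. (x, u) \<in> D \<and> AB S (x, u) \<in> range E"
proof -
  obtain x y where "(x, u) \<in> D" "S (x, u) = (\<mu> *\<^sub>C E x - 0, y)"
    using solution_exists by blast
  moreover have "\<mu> *\<^sub>C E x = E (\<mu> *\<^sub>C x)"
    by (simp add: E_simps)
  ultimately show ?thesis
    by (auto simp: AB_def)
qed

lemma F_op_invertible:
  assumes B: "is_control_op D S \<iota> B" and l: "l \<in> \<rho>"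
  shows "boundedly_invertible (F_op D S E \<iota> B l)"
proof -
  have "cbounded_linear (inv (T l))" "cbounded_linear B"
    using B T_invertible[OF l] by (simp_all add: is_control_op_def boundedly_invertible_def)
  then have "cbounded_linear (\<lambda>u. inv (T l) (B u))"
    by (rule cbounded_linear_compose)
  then show ?thesis
    unfolding F_op_def by (rule boundedly_invertible_shear)
qed

text \<open>Applying \<open>T l\<close> to the first component of the image gives an element of
  \<open>range \<iota>\<close> minus \<open>Am1 D S \<iota> x + B u\<close>. So that component is in
  dom A exactly if \<open>(x, u)\<close> satisfies the description of \<open>D\<close> by
  \<open>B\<close>.\<close>

lemma F_op_bij_betw:
  assumes B: "is_control_op D S \<iota> B" and l: "l \<in> \<rho>"
  shows "bij_betw (F_op D S E \<iota> B l) D (main_dom D \<times> UNIV)"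
proof -
  let ?F = "F_op D S E \<iota> B l"
  have iff: "p \<in> D \<longleftrightarrow> ?F p \<in> main_dom D \<times> UNIV" for p
  proof (cases p)
    case (Pair x u)
    let ?y = "x - inv (T l) (B u)"
    have "T l (inv (T l) (B u)) = B u"
      using T_invertible[OF l] by (simp add: boundedly_invertible_def bij_def surj_f_inv_f)
    moreover have "T l ?y = T l x - T l (inv (T l) (B u))"
      using T_bounded clinear_on_UNIV_simps(3) unfolding cbounded_linear_def by blast
    ultimately have "T l ?y = \<iota> (l *\<^sub>C E x) - (Am1 D S \<iota> x + B u)"
      by (simp add: pencil_def iota_simps)
    then have "?y \<in> main_dom D \<longleftrightarrow> Am1 D S \<iota> x + B u \<in> range \<iota>"
      using T_in_range_iota_iff[OF l, of ?y] iota_diff_in_range_iff by simp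
    also have "\<dots> \<longleftrightarrow> (x, u) \<in> D"
      using B unfolding is_control_op_def by blast
    finally show ?thesis
      by (simp add: Pair F_op_def)
  qed
  have "bij ?F"
    using F_op_invertible[OF B l] by (simp add: boundedly_invertible_def)
  then show ?thesis
    using iff by (rule bij_betw_preimage)
qed

end

theorem lemma3p3:
  fixes D :: "('x::chilbert_space \<times> 'u::chilbert_space) set"
    and S :: "'x \<times> 'u \<Rightarrow> 'z::chilbert_space \<times> 'y::chilbert_space"
    and E :: "'x \<Rightarrow> 'z"
    and \<mu> :: complex
    and \<iota> :: "'z \<Rightarrow> 'w::cbanach"
  assumes "operator_node D S E"
    and "\<mu> \<in> resolvent_set E (main_dom D) (main_op S)"
    and "is_Zm1 D S E \<mu> \<iota>"
  shows
    "(\<exists>!B. is_control_op D S \<iota> B)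
     \<and> (continuous_wrt D (graph_norm S) (CD S)
        \<and> continuous_wrt D (graph_norm (AB S)) (CD S)
        \<and> continuous_wrt (main_dom D) (norm_X1 S E \<mu>) (\<lambda>x. CD S (x, 0)))
     \<and> (\<forall>u. \<exists>x. (x, u) \<in> D \<and> AB S (x, u) \<in> range E)
     \<and> (\<forall>B. is_control_op D S \<iota> B \<longrightarrow>
          (\<forall>l\<in>resolvent_set E (main_dom D) (main_op S).
             boundedly_invertible (F_op D S E \<iota> B l) \<and>
             bij_betw (F_op D S E \<iota> B l) D (main_dom D \<times> UNIV)))"
proof -
  interpret node_with_extrapolation D S E \<mu> \<iota>
    using assms by unfold_locales
  show ?thesis
  proof (intro conjI ballI allI impI)
    show "\<exists>!B. is_control_op D S \<iota> B"
      using control_op_exists control_op_unique by blast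
    fix u show "\<exists>x. (x, u) \<in> D \<and> AB S (x, u) \<in> range E"
      by (rule input_reaches_range_E)
  qed (simp_all add: CD_continuous_S CD_continuous_AB C_continuous F_op_invertible F_op_bij_betw)
qed

end
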